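(* Let $n\ge 1$ and $1\le k\le n-1$. Then $$\mathfrak{WA}_{n,k}(x):=\sum_{\sigma\in\mathfrak{S}_n} x^{\mathrm{des}_k^A(\sigma)}=\sum_{p=0}^{\lfloor (n-k)/2\rfloor}\gamma^A_{n,k,p}\,x^p(1+x)^{n-k-2p},$$ where $\gamma^A_{n,k,p}=|\Gamma_{n,k,p}|$ and $\Gamma_{n,k,p}$ is the set of permutations $\sigma\in\mathfrak{S}_n$ with $\mathrm{des}_k^A(\sigma)=p$ and $\mathrm{ddes}_k^A(\sigma)=0$.
   Context: $\mathfrak{S}_n$ is the symmetric group on $[n]=\{1,\dots,n\}$; a permutation is written $\sigma=(\sigma(1),\dots,\sigma(n))$. For $1\le k\le n$, the number of width-$k$ descents is $\mathrm{des}_k^A(\sigma)=|\{i\in[n-k]:\sigma(i)>\sigma(i+k)\}|$. The number of width-$k$ double descents is $\mathrm{ddes}_k^A(\sigma)=|\{i\in[n]:\sigma(i-k)>\sigma(i)>\sigma(i+k)\}|$, where by convention $\sigma(j)=\infty$ for all $j\le 0$ and all $j>n$. *)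

theory Defs
  imports
    Main
    "HOL-Library.Extended_Nat"
    "HOL-Computational_Algebra.Polynomial"
    "HOL-Combinatorics.Permutations"
begin

definition des_A :: "nat \<Rightarrow> nat \<Rightarrow> (nat \<Rightarrow> nat) \<Rightarrow> nat" where
  "des_A n k \<sigma> = card {i \<in> {1..n - k}. \<sigma> i > \<sigma> (i + k)}"

text \<open>
  The word of \<open>\<sigma>\<close> is padded by infinity outside \<open>{1..n}\<close>. The index is an integer,
  so that \<open>i - k\<close> below is not truncated.
\<close>

definition padded :: "nat \<Rightarrow> (nat \<Rightarrow> nat) \<Rightarrow> int \<Rightarrow> enat" where
  "padded n \<sigma> j = (if 1 \<le> j \<and> j \<le> int n then enat (\<sigma> (nat j)) else \<infinity>)"

definition ddes_A :: "nat \<Rightarrow> nat \<Rightarrow> (nat \<Rightarrow> nat) \<Rightarrow> nat" where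
  "ddes_A n k \<sigma> = card {i \<in> {1..int n}.
     padded n \<sigma> (i - int k) > padded n \<sigma> i \<and> padded n \<sigma> i > padded n \<sigma> (i + int k)}"

abbreviation X :: "int poly" where
  "X \<equiv> [:0, 1:]"

definition WA :: "nat \<Rightarrow> nat \<Rightarrow> int poly" where
  "WA n k = (\<Sum>\<sigma> | \<sigma> permutes {1..n}. X ^ des_A n k \<sigma>)"

definition Gamma_A :: "nat \<Rightarrow> nat \<Rightarrow> nat \<Rightarrow> (nat \<Rightarrow> nat) set" where
  "Gamma_A n k p = {\<sigma>. \<sigma> permutes {1..n} \<and> des_A n k \<sigma> = p \<and> ddes_A n k \<sigma> = 0}"

definition gamma_A :: "nat \<Rightarrow> nat \<Rightarrow> nat \<Rightarrow> nat" where
  "gamma_A n k p = card (Gamma_A n k p)"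

end

theory Submission
  imports Defs
begin

text \<open>
  Give a position weight \<open>1\<close>, \<open>a\<close>, \<open>b\<close> or \<open>c\<close> if it is a valley, a double descent, a double ascent
  or a peak with respect to its neighbours at distance \<open>k\<close>. The weights \<open>(a, b, c) = (x, 1, x)\<close>
  produce \<open>x ^ des\<close>, while \<open>(0, 1 + x, x)\<close> produce \<open>x ^ des * (1 + x) ^ (n - k - 2 * des)\<close> on
  permutations without double descents and \<open>0\<close> elsewhere, so it suffices that the total weight
  depends on \<open>a\<close> and \<open>b\<close> only through \<open>a + b\<close>. Fill a set of positions in decreasing order of the
  values: the maximum is a double descent (double ascent) iff it is placed at the left (right) end
  of a maximal run of length at least two. Deleting either end of a run leaves isomorphic sets of
  positions, so both ends are followed by the same total weight, and induction applies.
\<close>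

section \<open>Arrangements of a set of positions\<close>

text \<open>The default 0 outside \<open>B\<close> makes an arrangement determined by its values on
  \<open>B\<close>, so there are finitely many of them and deleting a position is the update
  \<open>g(i := 0)\<close>.\<close>

definition arrangements :: "'a set \<Rightarrow> ('a \<Rightarrow> nat) set" where
  "arrangements B = {g. bij_betw g B {1..card B} \<and> (\<forall>i. i \<notin> B \<longrightarrow> g i = 0)}"

fun weight :: "'a \<Rightarrow> 'a \<Rightarrow> 'a \<Rightarrow> bool \<Rightarrow> bool \<Rightarrow> 'a::comm_semiring_1" where
  "weight a b c False False = 1"
| "weight a b c False True = a"
| "weight a b c True False = b"
| "weight a b c True True = c"

text \<open>Positions outside \<open>B\<close> count as carrying the value infinity.\<close>

definition left_smaller :: "nat \<Rightarrow> nat set \<Rightarrow> (nat \<Rightarrow> nat) \<Rightarrow> nat \<Rightarrow> bool" where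
  "left_smaller k B g i \<longleftrightarrow> (\<exists>j\<in>B. i = j + k \<and> g j < g i)"

definition right_smaller :: "nat \<Rightarrow> nat set \<Rightarrow> (nat \<Rightarrow> nat) \<Rightarrow> nat \<Rightarrow> bool" where
  "right_smaller k B g i \<longleftrightarrow> i + k \<in> B \<and> g (i + k) < g i"

definition weighted_sum :: "'a \<Rightarrow> 'a \<Rightarrow> 'a \<Rightarrow> nat \<Rightarrow> nat set \<Rightarrow> 'a::comm_semiring_1" where
  "weighted_sum a b c k B =
     (\<Sum>g\<in>arrangements B. \<Prod>i\<in>B. weight a b c (left_smaller k B g i) (right_smaller k B g i))"

lemma finite_arrangements:
  assumes "finite B"
  shows "finite (arrangements B)"
proof -
  have "arrangements B \<subseteq> {g. \<forall>i. (i \<in> B \<longrightarrow> g i \<in> {1..card B}) \<and> (i \<notin> B \<longrightarrow> g i = 0)}"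
    by (auto simp: arrangements_def dest: bij_betwE)
  then show ?thesis
    by (rule finite_subset) (intro finite_set_of_finite_funs assms finite_atLeastAtMost)
qed

text \<open>With \<open>arrangements_remove_max\<close> this gives the two mutually inverse maps
  behind the recursion: an arrangement amounts to the position of its maximum and an arrangement of
  the remaining positions.\<close>

lemma arrangements_insert_max:
  assumes "finite B" "i \<in> B" "h \<in> arrangements (B - {i})"
  shows "h(i := card B) \<in> arrangements B"
proof -
  have c: "card B = Suc (card (B - {i}))"
    using card_Suc_Diff1[OF assms(1,2)] by simp
  have "bij_betw h (B - {i}) {1..card (B - {i})}"
    using assms by (auto simp: arrangements_def)
  then have "bij_betw (h(i := card B)) (B - {i}) {1..card (B - {i})}"
    by (rule bij_betw_cong[THEN iffD1, rotated]) auto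
  then have "bij_betw (h(i := card B)) (insert i (B - {i})) (insert (card B) {1..card (B - {i})})"
    using notIn_Un_bij_betw[of i "B - {i}" "h(i := card B)" "{1..card (B - {i})}"]
    by (simp add: c)
  moreover have "insert (card B) {1..card (B - {i})} = {1..card B}"
    using c by auto
  moreover have "insert i (B - {i}) = B"
    using assms(2) by blast
  ultimately show ?thesis
    using assms(2,3) by (simp add: arrangements_def)
qed

lemma arrangements_remove_max:
  assumes "finite B" "i \<in> B" "g \<in> arrangements B" "g i = card B"
  shows "g(i := 0) \<in> arrangements (B - {i})"
proof -
  have c: "card B = Suc (card (B - {i}))"
    using card_Suc_Diff1[OF assms(1,2)] by simp
  have "bij_betw g B {1..card B}"
    using assms by (auto simp: arrangements_def)
  then have "bij_betw g (B - {i}) ({1..card B} - {g i})"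
    using assms(2) bij_betw_subset[of g B _ "B - {i}"] inj_on_image_set_diff[of g B B "{i}"]
    by (auto simp: bij_betw_def inj_on_diff)
  moreover have "{1..card B} - {g i} = {1..card (B - {i})}"
    using c assms(4) by auto
  ultimately have "bij_betw g (B - {i}) {1..card (B - {i})}"
    by simp
  then have "bij_betw (g(i := 0)) (B - {i}) {1..card (B - {i})}"
    by (rule bij_betw_cong[THEN iffD1, rotated]) auto
  then show ?thesis
    using assms by (auto simp: arrangements_def)
qed

lemma weighted_sum_empty: "weighted_sum a b c k {} = 1"
proof -
  have "arrangements ({} :: nat set) = {\<lambda>_. 0}"
    by (auto simp: arrangements_def bij_betw_def)
  then show ?thesis
    by (simp add: weighted_sum_def)
qed

section \<open>Recursion on the position of the maximum\<close>

text \<open>Sort the arrangements by the position \<open>i\<close> of the maximum. Any neighbour of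
  \<open>i\<close> that lies in \<open>B\<close> carries a smaller value, so the two flags of
  \<open>i\<close> reduce to membership of its neighbours in \<open>B\<close>.\<close>

lemma weighted_sum_rec:
  assumes fin: "finite B" and ne: "B \<noteq> {}" and k: "k > 0"
  shows "weighted_sum a b c k B =
    (\<Sum>i\<in>B. weight a b c (\<exists>j\<in>B. i = j + k) (i + k \<in> B) * weighted_sum a b c k (B - {i}))"
proof -
  let ?P = "\<lambda>B g. \<Prod>i\<in>B. weight a b c (left_smaller k B g i) (right_smaller k B g i)"
  let ?w = "\<lambda>i. weight a b c (\<exists>j\<in>B. i = j + k) (i + k \<in> B)"
  have uniq: "i = j" if "g \<in> arrangements B" "i \<in> B" "j \<in> B" "g i = g j" for g i j
    using that by (auto simp: arrangements_def bij_betw_def dest: inj_onD)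
  have ex: "\<exists>!i. i \<in> B \<and> g i = card B" if g: "g \<in> arrangements B" for g
  proof -
    have "card B \<in> g ` B"
      using g fin ne by (auto simp: arrangements_def bij_betw_def Suc_le_eq card_gt_0_iff)
    then show ?thesis
      using uniq[OF g] by (metis imageE)
  qed
  define pos where "pos g = (THE i. i \<in> B \<and> g i = card B)" for g :: "nat \<Rightarrow> nat"
  have pos: "pos g \<in> B" "g (pos g) = card B" if "g \<in> arrangements B" for g
    using theI'[OF ex[OF that]] by (auto simp: pos_def)
  have pos_eq: "pos g = i" if "g \<in> arrangements B" "i \<in> B" "g i = card B" for g i
    using uniq[OF that(1) pos(1)[OF that(1)] that(2)] pos(2)[OF that(1)] that(3) by simp
  have split: "?P B (h(i := card B)) = ?w i * ?P (B - {i}) h"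
    if i: "i \<in> B" and h: "h \<in> arrangements (B - {i})" for i h
  proof -
    let ?g = "h(i := card B)"
    have lt: "h j < card B" if "j \<in> B - {i}" for j
    proof -
      have "h j \<in> {1..card (B - {i})}"
        using h that by (auto simp: arrangements_def dest: bij_betwE)
      moreover have "card (B - {i}) < card B"
        using fin i by (rule card_Diff1_less)
      ultimately show ?thesis by simp
    qed
    have 1: "left_smaller k B ?g i = (\<exists>j\<in>B. i = j + k)"
    proof
      assume "\<exists>j\<in>B. i = j + k"
      then obtain j where j: "j \<in> B" "i = j + k" by blast
      then have "j \<in> B - {i}" using k by simp
      from lt[OF this] j k show "left_smaller k B ?g i"
        unfolding left_smaller_def by (intro bexI[of _ j]) auto
    qed (auto simp: left_smaller_def)
    have 2: "right_smaller k B ?g i = (i + k \<in> B)"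
      using lt[of "i + k"] k by (auto simp: right_smaller_def)
    \<comment> \<open>For every other position a neighbour carrying the maximum counts as not
      smaller, exactly as if it were missing from the set.\<close>
    have 3: "left_smaller k B ?g j = left_smaller k (B - {i}) h j"
      if "j \<in> B - {i}" for j
      using lt[OF that] that by (auto simp: left_smaller_def)
    have 4: "right_smaller k B ?g j = right_smaller k (B - {i}) h j"
      if "j \<in> B - {i}" for j
      using lt[OF that] that by (auto simp: right_smaller_def)
    have "?P B ?g = weight a b c (left_smaller k B ?g i) (right_smaller k B ?g i) *
       (\<Prod>j\<in>B - {i}. weight a b c (left_smaller k B ?g j) (right_smaller k B ?g j))"
      using fin i by (rule prod.remove)
    also have "\<dots> = ?w i * ?P (B - {i}) h"
      unfolding 1 2 using 3 4 by (intro arg_cong2[where f = "(*)"] prod.cong) auto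
    finally show ?thesis .
  qed
  have "(\<Sum>i\<in>B. ?w i * weighted_sum a b c k (B - {i}))
      = (\<Sum>i\<in>B. \<Sum>h\<in>arrangements (B - {i}). ?w i * ?P (B - {i}) h)"
    by (simp add: weighted_sum_def sum_distrib_left)
  also have "\<dots> = (\<Sum>(i, h)\<in>(SIGMA i:B. arrangements (B - {i})). ?w i * ?P (B - {i}) h)"
    using fin by (intro sum.Sigma) (auto intro: finite_arrangements)
  also have "\<dots> = (\<Sum>g\<in>arrangements B. ?P B g)"
  proof (rule sum.reindex_bij_witness[where
        i = "\<lambda>g. (pos g, g(pos g := 0))" and j = "\<lambda>(i, h). h(i := card B)"])
    fix x assume x: "x \<in> (SIGMA i:B. arrangements (B - {i}))"
    obtain i h where [simp]: "x = (i, h)" by (cases x)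
    have i: "i \<in> B" and h: "h \<in> arrangements (B - {i})" using x by auto
    have g: "h(i := card B) \<in> arrangements B"
      using arrangements_insert_max[OF fin i h] .
    have p: "pos (h(i := card B)) = i"
      using pos_eq[OF g i] by simp
    \<comment> \<open>The default value at the deleted position is what makes resetting it to 0
      recover \<open>h\<close>.\<close>
    have "h i = 0" using h by (simp add: arrangements_def)
    then show "(pos (case x of (i, h) \<Rightarrow> h(i := card B)),
          (case x of (i, h) \<Rightarrow> h(i := card B))
          (pos (case x of (i, h) \<Rightarrow> h(i := card B)) := 0)) = x"
      using p by auto
    show "(case x of (i, h) \<Rightarrow> h(i := card B)) \<in> arrangements B" using g by simp
    show "?P B (case x of (i, h) \<Rightarrow> h(i := card B)) =
        (case x of (i, h) \<Rightarrow> ?w i * ?P (B - {i}) h)"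
      using split[OF i h] by simp
  next
    fix g assume g: "g \<in> arrangements B"
    show "(case (pos g, g(pos g := 0)) of (i, h) \<Rightarrow> h(i := card B)) = g"
      using pos[OF g] by auto
    show "(pos g, g(pos g := 0)) \<in> (SIGMA i:B. arrangements (B - {i}))"
      using arrangements_remove_max[OF fin pos(1)[OF g] g pos(2)[OF g]] pos[OF g] by auto
  qed
  finally show ?thesis
    by (simp add: weighted_sum_def)
qed

text \<open>The recursion looks at \<open>B\<close> only through the relation "\<open>y\<close> is
  \<open>x + k\<close>". A bijection that preserves and reflects it still does so after deleting
  \<open>i\<close> and \<open>p i\<close>, so induction on the cardinality applies.\<close>

lemma weighted_sum_isomorphic:
  assumes "finite B" "k > 0" "bij_betw p B C"
    and "\<And>x y. x \<in> B \<Longrightarrow> y \<in> B \<Longrightarrow> p y = p x + k \<longleftrightarrow> y = x + k"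
  shows "weighted_sum a b c k C = weighted_sum a b c k B"
  using assms
proof (induction "card B" arbitrary: B C)
  case 0
  then have "B = {}" "C = {}" by (auto simp: bij_betw_def)
  then show ?case by simp
next
  case (Suc m)
  have fin: "finite C" using Suc.prems bij_betw_finite by blast
  have ne: "B \<noteq> {}" "C \<noteq> {}" using Suc.hyps Suc.prems by (auto simp: bij_betw_def)
  have CB: "C = p ` B" using Suc.prems by (auto simp: bij_betw_def)
  have "weighted_sum a b c k C =
      (\<Sum>i\<in>B. weight a b c (\<exists>j\<in>C. p i = j + k) (p i + k \<in> C) * weighted_sum a b c k (C - {p i}))"
    unfolding weighted_sum_rec[OF fin ne(2) Suc.prems(2)]
    by (rule sum.reindex_bij_betw[OF Suc.prems(3), symmetric])
  also have "\<dots> = weighted_sum a b c k B"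
    unfolding weighted_sum_rec[OF Suc.prems(1) ne(1) Suc.prems(2)]
  proof (rule sum.cong[OF refl])
    fix i assume i: "i \<in> B"
    have 1: "(\<exists>j\<in>C. p i = j + k) = (\<exists>j\<in>B. i = j + k)"
      unfolding CB bex_simps(7) using Suc.prems(4)[OF _ i] by (intro bex_cong) auto
    have 2: "(p i + k \<in> C) = (i + k \<in> B)"
      proof -
      have "p i + k \<in> C \<longleftrightarrow> (\<exists>y\<in>B. p y = p i + k)" unfolding CB by (metis imageE imageI)
      also have "\<dots> \<longleftrightarrow> (\<exists>y\<in>B. y = i + k)" using Suc.prems(4)[OF i] by (intro bex_cong) auto
      finally show ?thesis by blast
    qed
    have "bij_betw p (B - {i}) (C - {p i})"
      using Suc.prems(3) i by (intro bij_betw_DiffI) (auto simp: bij_betw_def)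
    then have "weighted_sum a b c k (C - {p i}) = weighted_sum a b c k (B - {i})"
      using Suc.prems Suc.hyps(2) i by (intro Suc.hyps(1)) auto
    then show "weight a b c (\<exists>j\<in>C. p i = j + k) (p i + k \<in> C) * weighted_sum a b c k (C - {p i}) =
        weight a b c (\<exists>j\<in>B. i = j + k) (i + k \<in> B) * weighted_sum a b c k (B - {i})"
      unfolding 1 2 by simp
  qed
  finally show ?case .
qed

section \<open>Runs of positions and the exchange of their ends\<close>

text \<open>Maximality is not built in; where it matters, it is expressed by separate conditions
  that the left neighbour of \<open>i\<close> and the right neighbour of \<open>j\<close> are
  missing from \<open>B\<close>.\<close>

definition run :: "nat \<Rightarrow> nat set \<Rightarrow> nat \<Rightarrow> nat \<Rightarrow> bool" where
  "run k B i j \<longleftrightarrow> (\<exists>m. j = i + m * k \<and> (\<forall>t\<le>m. i + t * k \<in> B))"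

text \<open>Walking left in steps of \<open>k\<close> strictly decreases a natural number, so the
  walk ends.\<close>

lemma run_left_end_exists:
  assumes "k > 0" "j \<in> B"
  shows "\<exists>i\<in>B. run k B i j \<and> \<not> (\<exists>x\<in>B. i = x + k)"
  using assms(2)
proof (induction j rule: less_induct)
  case (less j)
  show ?case
  proof (cases "\<exists>x\<in>B. j = x + k")
    case True
    then obtain x where x: "x \<in> B" "j = x + k" by blast
    have "x < j" using x assms(1) by simp
    from less.IH[OF this x(1)] obtain i
      where i: "i \<in> B" "run k B i x" "\<not> (\<exists>x\<in>B. i = x + k)"
      by blast
    then obtain m where m: "x = i + m * k" "\<forall>t\<le>m. i + t * k \<in> B"
      by (auto simp: run_def)
    have "run k B i j"
      unfolding run_def
    proof (intro exI[of _ "Suc m"] conjI allI impI)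
      show j: "j = i + Suc m * k" using m x by simp
      show "i + t * k \<in> B" if "t \<le> Suc m" for t
        using that m(2) j less.prems by (cases "t = Suc m") auto
    qed
    with i show ?thesis by blast
  next
    case False
    moreover have "run k B j j"
      unfolding run_def using less.prems by (intro exI[of _ 0]) simp
    ultimately show ?thesis using less.prems by blast
  qed
qed

text \<open>Walking right must leave the finite set \<open>B\<close>, since the progression has
  infinitely many members.\<close>

lemma run_right_end_exists:
  assumes "finite B" "k > 0" "i \<in> B"
  shows "\<exists>j\<in>B. run k B i j \<and> j + k \<notin> B"
proof -
  have "\<exists>m. i + m * k \<notin> B"
  proof (rule ccontr)
    assume "\<not> ?thesis"
    then have "range (\<lambda>m. i + m * k) \<subseteq> B" by auto
    moreover have "inj (\<lambda>m. i + m * k)" using assms(2) by (auto simp: inj_def)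
    ultimately show False
      using assms(1) by (metis finite_subset finite_imageD infinite_UNIV_nat)
  qed
  define m where "m = (LEAST m. i + m * k \<notin> B)"
  have m: "i + m * k \<notin> B" unfolding m_def using \<open>\<exists>m. _\<close> by (rule LeastI_ex)
  have less: "i + t * k \<in> B" if "t < m" for t
    using not_less_Least[of t "\<lambda>m. i + m * k \<notin> B"] that unfolding m_def by blast
  \<comment> \<open>The first exit \<open>m\<close> is positive because \<open>i\<close> itself is
    in \<open>B\<close>; the run ends one step before it.\<close>
  obtain q where q: "m = Suc q"
    using m assms(3) by (cases m) auto
  have "run k B i (i + q * k)"
    unfolding run_def using less q by (intro exI[of _ q]) simp
  moreover have "i + q * k \<in> B"
    using less q by simp
  moreover have "i + q * k + k \<notin> B"
    using m q by (simp add: algebra_simps)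
  ultimately show ?thesis by blast
qed

text \<open>Of two runs with different lengths from the same start, the longer would contain the
  position just after the end of the shorter.\<close>

lemma run_right_end_unique:
  assumes "run k B i j" "j + k \<notin> B" "run k B i j'" "j' + k \<notin> B"
  shows "j = j'"
proof -
  obtain m m' where m: "j = i + m * k" "\<forall>t\<le>m. i + t * k \<in> B"
      "j' = i + m' * k" "\<forall>t\<le>m'. i + t * k \<in> B"
    using assms by (auto simp: run_def)
  have "\<not> m < m'" using m(1) m(4)[rule_format, of "Suc m"] assms(2) by (auto simp: algebra_simps)
  moreover have "\<not> m' < m" using m(3) m(2)[rule_format, of "Suc m'"] assms(4) by (auto simp: algebra_simps)
  ultimately show ?thesis using m by simp
qed

lemma run_left_end_unique:
  assumes "run k B i j" "\<not> (\<exists>x\<in>B. i = x + k)" "run k B i' j" "\<not> (\<exists>x\<in>B. i' = x + k)"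
  shows "i = i'"
proof -
  have aux: "\<not> m < m'" if "j = i + m * k" "j = i' + m' * k" "\<forall>t\<le>m'. i' + t * k \<in> B"
    "\<not> (\<exists>x\<in>B. i = x + k)" for i i' m m'
  proof
    assume "m < m'"
    then obtain d where d: "m' = m + Suc d" using less_imp_Suc_add by auto
    then have "i = (i' + d * k) + k" using that(1,2) by (simp add: algebra_simps)
    moreover have "i' + d * k \<in> B" using that(3) d by simp
    ultimately show False using that(4) by blast
  qed
  obtain m m' where m: "j = i + m * k" "\<forall>t\<le>m. i + t * k \<in> B"
      "j = i' + m' * k" "\<forall>t\<le>m'. i' + t * k \<in> B"
    using assms(1,3) unfolding run_def by blast
  then have "m = m'" using aux assms by (metis nat_neq_iff)
  then show ?thesis using m by simp
qed

text \<open>Shifting all positions of the run except \<open>i\<close> down by \<open>k\<close> turns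
  \<open>B - {i}\<close> into \<open>B - {j}\<close>. Since \<open>i\<close> and \<open>j\<close>
  end a maximal run, no adjacency with the rest of \<open>B\<close> is created or destroyed.\<close>

lemma weighted_sum_remove_end:
  assumes "finite B" "k > 0" "run k B i j" "\<not> (\<exists>x\<in>B. i = x + k)" "j + k \<notin> B"
  shows "weighted_sum a b c k (B - {j}) = weighted_sum a b c k (B - {i})"
proof -
  obtain m where j: "j = i + m * k" and B: "\<And>t. t \<le> m \<Longrightarrow> i + t * k \<in> B"
    using assms(3) by (auto simp: run_def)
  \<comment> \<open>\<open>T\<close> is the run without its left end; \<open>p\<close> shifts it by
    one step and fixes everything else.\<close>
  define T where "T = {i + Suc t * k |t. t < m}"
  define p where "p x = (if x \<in> T then x - k else x)" for x
  have pT: "p (i + Suc t * k) = i + t * k" if "t < m" for t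
    using that by (auto simp: p_def T_def)
  have pN: "p x = x" if "x \<notin> T" for x using that by (simp add: p_def)
  have TI: "i + t * k \<in> T" if "t \<le> m" "t \<noteq> 0" for t
    using that by (cases t) (auto simp: T_def)
  have TE: "\<exists>t<m. x = i + Suc t * k" if "x \<in> T" for x using that by (auto simp: T_def)
  have adj: "p y = p x + k \<longleftrightarrow> y = x + k" if x: "x \<in> B - {i}" and y: "y \<in> B - {i}" for x y
  proof (cases "x \<in> T"; cases "y \<in> T")
    assume "x \<in> T" "y \<in> T"
    then obtain t u where tu: "t < m" "x = i + Suc t * k" "u < m" "y = i + Suc u * k"
      using TE by meson
    then show ?thesis using pT[OF tu(1)] pT[OF tu(3)] by auto
  next
    \<comment> \<open>Neither side can hold: a right neighbour of \<open>x\<close> outside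
      \<open>T\<close> could only be \<open>j + k\<close>, which is not in \<open>B\<close>, and
      after the shift adjacency would mean \<open>y = x\<close>.\<close>
    assume xT: "x \<in> T" and yT: "y \<notin> T"
    obtain t where t: "t < m" "x = i + Suc t * k" using TE[OF xT] by blast
    have "y \<noteq> x + k"
    proof
      assume e: "y = x + k"
      then have "y = i + Suc (Suc t) * k" using t by simp
      then have "Suc t = m" using TI[of "Suc (Suc t)"] yT t by (metis Suc_leI le_neq_implies_less nat.distinct(1))
      then have "y = j + k" using e t j by auto
      then show False using assms(5) y by simp
    qed
    moreover have "y \<noteq> x" using xT yT by auto
    ultimately show ?thesis using pT[OF t(1)] pN[OF yT] t(2) by (simp add: algebra_simps)
  next
    \<comment> \<open>Again both sides fail: \<open>x\<close> would be in \<open>T\<close>, or the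
      deleted \<open>i\<close>, or a left neighbour of \<open>i\<close>.\<close>
    assume xT: "x \<notin> T" and yT: "y \<in> T"
    obtain t where t: "t < m" "y = i + Suc t * k" using TE[OF yT] by blast
    have "y \<noteq> x + k"
    proof
      assume "y = x + k"
      then have "x = i + t * k" using t by simp
      then show False using TI[of t] xT x t by (cases "t = 0") auto
    qed
    moreover have "i + t * k \<noteq> x + k"
    proof
      assume e: "i + t * k = x + k"
      show False
      proof (cases t)
        case 0
        then show ?thesis using e assms(4) x by auto
      next
        case (Suc s)
        then have "x = i + s * k" using e by simp
        then show ?thesis using TI[of s] xT x t Suc by (cases "s = 0") auto
      qed
    qed
    ultimately show ?thesis using pT[OF t(1)] pN[OF xT] t(2) by simp
  next
    assume "x \<notin> T" "y \<notin> T"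
    then show ?thesis using pN by simp
  qed
  have "inj_on p (B - {i})"
  proof (rule inj_onI)
    \<comment> \<open>A shifted position lands in \<open>T\<close> or on \<open>i\<close>, hence
      never on a fixed position of \<open>B - {i}\<close>.\<close>
    have aux: "False" if xy: "x \<in> T" "y \<notin> T" "y \<in> B - {i}" "p x = p y" for x y
    proof -
      obtain t where t: "t < m" "x = i + Suc t * k" using TE[OF xy(1)] by blast
      have "y = i + t * k" using pT[OF t(1)] t(2) pN[OF xy(2)] xy(4) by simp
      then show False using TI[of t] xy t by (cases "t = 0") auto
    qed
    fix x y assume "x \<in> B - {i}" "y \<in> B - {i}" "p x = p y"
    then show "x = y"
    proof (cases "x \<in> T \<and> y \<in> T")
      case True
      then obtain t u where tu: "t < m" "x = i + Suc t * k" "u < m" "y = i + Suc u * k"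
        using TE by meson
      then show ?thesis using pT[OF tu(1)] pT[OF tu(3)] \<open>p x = p y\<close> by simp
    next
      case False
      then show ?thesis
        using aux[of x y] aux[of y x] pN \<open>x \<in> _\<close> \<open>y \<in> _\<close> \<open>p x = p y\<close> by metis
    qed
  qed
  moreover have "p ` (B - {i}) = B - {j}"
  proof
    show "p ` (B - {i}) \<subseteq> B - {j}"
    proof
      fix z assume "z \<in> p ` (B - {i})"
      then obtain x where x: "x \<in> B" "x \<noteq> i" "z = p x" by auto
      show "z \<in> B - {j}"
      proof (cases "x \<in> T")
        case True
        then obtain t where t: "t < m" "x = i + Suc t * k" using TE by blast
        then show ?thesis using x pT[OF t(1)] B[of t] j assms(2) by auto
      next
        case False
        then have "x \<noteq> j" using TI[of m] j x by (cases "m = 0") auto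
        then show ?thesis using x pN False by simp
      qed
    qed
    show "B - {j} \<subseteq> p ` (B - {i})"
    proof
      fix z assume z: "z \<in> B - {j}"
      show "z \<in> p ` (B - {i})"
      \<comment> \<open>A run position other than \<open>j\<close> is the image of its successor in
        the run; all positions off the run are fixed.\<close>
      proof (cases "\<exists>t<m. z = i + t * k")
        case True
        then obtain t where t: "t < m" "z = i + t * k" by blast
        then have "z = p (i + Suc t * k)" "i + Suc t * k \<in> B - {i}"
          using pT B[of "Suc t"] assms(2) by auto
        then show ?thesis by blast
      next
        case False
        have "z \<notin> T"
        proof
          assume "z \<in> T"
          then obtain t where t: "t < m" "z = i + Suc t * k" using TE by blast
          with False have "Suc t = m" by (metis Suc_lessI)
          then show False using z t j by simp
        qed
        moreover have "z \<noteq> i" using False z j by (cases "m = 0") auto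
        ultimately show ?thesis using z pN by (metis DiffD1 DiffI image_eqI singletonD)
      qed
    qed
  qed
  ultimately have "bij_betw p (B - {i}) (B - {j})" by (simp add: bij_betw_def)
  then show ?thesis
    using assms(1,2) adj by (intro weighted_sum_isomorphic[where p = p]) auto
qed

text \<open>Each maximal run with at least two positions has one left and one right end, and
  deleting either gives the same weighted sum. Matching the ends of each run matches the
  summands.\<close>

lemma sum_left_ends_eq_sum_right_ends:
  assumes fin: "finite B" and k: "k > 0"
  shows "(\<Sum>i | i \<in> B \<and> \<not> (\<exists>x\<in>B. i = x + k) \<and> i + k \<in> B. weighted_sum a b c k (B - {i})) =
         (\<Sum>i | i \<in> B \<and> (\<exists>x\<in>B. i = x + k) \<and> i + k \<notin> B. weighted_sum a b c k (B - {i}))"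
proof -
  define L where "L = {i \<in> B. \<not> (\<exists>x\<in>B. i = x + k) \<and> i + k \<in> B}"
  define R where "R = {i \<in> B. (\<exists>x\<in>B. i = x + k) \<and> i + k \<notin> B}"
  define right where "right i = (THE j. j \<in> R \<and> run k B i j)" for i
  define left where "left j = (THE i. i \<in> L \<and> run k B i j)" for j
  have exR: "\<exists>!j. j \<in> R \<and> run k B i j" if i: "i \<in> L" for i
  proof -
    obtain j where j: "j \<in> B" "run k B i j" "j + k \<notin> B"
      using run_right_end_exists[OF fin k, of i] i by (auto simp: L_def)
    obtain m where m: "j = i + m * k" "\<forall>t\<le>m. i + t * k \<in> B"
      using j by (auto simp: run_def)
    \<comment> \<open>The run has more than one position: \<open>i + k\<close> is in
      \<open>B\<close> but \<open>j + k\<close> is not, so \<open>i\<close> and \<open>j\<close>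
      differ.\<close>
    obtain q where q: "m = Suc q" using m(1) j i by (cases m) (auto simp: L_def)
    have "j = (i + q * k) + k" "i + q * k \<in> B" using m q by auto
    then have "j \<in> R" using j unfolding R_def by blast
    moreover have "j' = j" if "j' \<in> R \<and> run k B i j'" for j'
      using run_right_end_unique[of k B i j' j] that j by (auto simp: R_def)
    ultimately show ?thesis using j by blast
  qed
  have exL: "\<exists>!i. i \<in> L \<and> run k B i j" if j: "j \<in> R" for j
  proof -
    obtain i where i: "i \<in> B" "run k B i j" "\<not> (\<exists>x\<in>B. i = x + k)"
      using run_left_end_exists[OF k, of j B] j by (auto simp: R_def)
    obtain m where m: "j = i + m * k" "\<forall>t\<le>m. i + t * k \<in> B"
      using i by (auto simp: run_def)
    \<comment> \<open>Here \<open>j\<close> has a left neighbour in \<open>B\<close> and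
      \<open>i\<close> has none, so the run is again nontrivial.\<close>
    have "m \<noteq> 0" using m(1) i(3) j by (intro notI) (simp add: R_def)
    then have "i + k \<in> B" using m(2)[rule_format, of 1] by simp
    then have "i \<in> L" using i by (simp add: L_def)
    moreover have "i' = i" if "i' \<in> L \<and> run k B i' j" for i'
      using run_left_end_unique[of k B i' j i] that i by (auto simp: L_def)
    ultimately show ?thesis using i by blast
  qed
  have right: "right i \<in> R" "run k B i (right i)" if "i \<in> L" for i
    using theI'[OF exR[OF that]] by (auto simp: right_def)
  have left: "left j \<in> L" "run k B (left j) j" if "j \<in> R" for j
    using theI'[OF exL[OF that]] by (auto simp: left_def)
  have "(\<Sum>i\<in>L. weighted_sum a b c k (B - {i})) = (\<Sum>i\<in>R. weighted_sum a b c k (B - {i}))"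
  proof (rule sum.reindex_bij_witness[where i = left and j = right])
    fix i assume i: "i \<in> L"
    show "left (right i) = i" using exL[OF right(1)[OF i]] left[OF right(1)[OF i]] right[OF i] i by blast
    show "right i \<in> R" using right[OF i] by simp
    show "weighted_sum a b c k (B - {right i}) = weighted_sum a b c k (B - {i})"
      using weighted_sum_remove_end[OF fin k right(2)[OF i]] right(1)[OF i] i
      unfolding L_def R_def by blast
  next
    fix j assume j: "j \<in> R"
    show "right (left j) = j" using exR[OF left(1)[OF j]] right[OF left(1)[OF j]] left[OF j] j by blast
    show "left j \<in> L" using left[OF j] by simp
  qed
  then show ?thesis by (simp add: L_def R_def)
qed

text \<open>In the recursion \<open>a\<close> multiplies the sum over left ends and \<open>b\<close>
  the equal sum over right ends, so only \<open>a + b\<close> survives; the sums for smaller sets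
  agree by induction.\<close>

lemma weighted_sum_cong_add:
  assumes "finite B" "k > 0" "a + b = a' + b'"
  shows "weighted_sum a b c k B = weighted_sum a' b' c k B"
  using assms(1)
proof (induction "card B" arbitrary: B)
  case 0
  then show ?case by (simp add: weighted_sum_empty)
next
  case (Suc m)
  have ne: "B \<noteq> {}" using Suc.hyps by auto
  define V where "V i = weighted_sum a b c k (B - {i})" for i
  have IH: "weighted_sum a' b' c k (B - {i}) = V i" if "i \<in> B" for i
    using Suc.hyps(1)[of "B - {i}"] Suc.hyps(2) Suc.prems that by (simp add: V_def)
  define l where "l i = (\<exists>j\<in>B. i = j + k)" for i
  define r where "r i = (i + k \<in> B)" for i
  \<comment> \<open>Here \<open>a\<close> and \<open>b\<close> are arbitrary while \<open>V\<close>
    keeps the original weights, so the identity serves both sides of the claim.\<close>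
  have expand: "(\<Sum>i\<in>B. weight a b c (l i) (r i) * V i) =
      (\<Sum>i | i \<in> B \<and> \<not> l i \<and> \<not> r i. V i) + (a + b) * (\<Sum>i | i \<in> B \<and> \<not> l i \<and> r i. V i)
      + c * (\<Sum>i | i \<in> B \<and> l i \<and> r i. V i)" for a b
  proof -
    have "weight a b c (l i) (r i) * V i =
        (if \<not> l i \<and> \<not> r i then V i else 0) + a * (if \<not> l i \<and> r i then V i else 0)
        + b * (if l i \<and> \<not> r i then V i else 0) + c * (if l i \<and> r i then V i else 0)" for i
      by (cases "l i"; cases "r i") auto
    moreover have "(\<Sum>i | i \<in> B \<and> l i \<and> \<not> r i. V i) = (\<Sum>i | i \<in> B \<and> \<not> l i \<and> r i. V i)"
      unfolding V_def l_def r_def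
      by (rule sum_left_ends_eq_sum_right_ends[OF Suc.prems assms(2), symmetric])
    ultimately show ?thesis
      using Suc.prems
      by (simp add: sum.distrib sum_distrib_left[symmetric] sum.inter_filter[symmetric] distrib_right
          add.assoc)
  qed
  have "weighted_sum a b c k B = (\<Sum>i\<in>B. weight a b c (l i) (r i) * V i)"
    unfolding weighted_sum_rec[OF Suc.prems ne assms(2)] l_def r_def V_def ..
  also have "\<dots> = (\<Sum>i\<in>B. weight a' b' c (l i) (r i) * V i)"
    unfolding expand assms(3) ..
  also have "\<dots> = weighted_sum a' b' c k B"
    unfolding weighted_sum_rec[OF Suc.prems ne assms(2)] l_def r_def using IH by simp
  finally show ?case .
qed

section \<open>From weights to descent statistics\<close>

text \<open>Only the default outside \<open>{1..n}\<close> differs, 0 for arrangements and the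
  identity for permutations, and the flags never read values there.\<close>

lemma weighted_sum_permutations:
  "weighted_sum a b c k {1..n} = (\<Sum>\<sigma> | \<sigma> permutes {1..n}.
     \<Prod>i\<in>{1..n}. weight a b c (left_smaller k {1..n} \<sigma> i) (right_smaller k {1..n} \<sigma> i))"
  unfolding weighted_sum_def
proof (rule sum.reindex_bij_witness[where
      i = "\<lambda>\<sigma> i. if i \<in> {1..n} then \<sigma> i else 0" and j = "\<lambda>g i. if i \<in> {1..n} then g i else i"])
  fix g assume g: "g \<in> arrangements {1..n}"
  let ?s = "\<lambda>i. if i \<in> {1..n} then g i else i"
  show "(\<lambda>i. if i \<in> {1..n} then ?s i else 0) = g"
    using g by (auto simp: arrangements_def)
  have "bij_betw g {1..n} {1..n}" using g by (simp add: arrangements_def)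
  then have "bij_betw ?s {1..n} {1..n}"
    by (rule bij_betw_cong[THEN iffD1, rotated]) auto
  then show "?s \<in> {\<sigma>. \<sigma> permutes {1..n}}"
    using bij_imp_permutes by fastforce
  show "(\<Prod>i\<in>{1..n}. weight a b c (left_smaller k {1..n} ?s i) (right_smaller k {1..n} ?s i)) =
      (\<Prod>i\<in>{1..n}. weight a b c (left_smaller k {1..n} g i) (right_smaller k {1..n} g i))"
  proof (rule prod.cong[OF refl])
    fix i assume "i \<in> {1..n}"
    then have "left_smaller k {1..n} ?s i = left_smaller k {1..n} g i"
      "right_smaller k {1..n} ?s i = right_smaller k {1..n} g i"
      unfolding left_smaller_def right_smaller_def by auto
    then show "weight a b c (left_smaller k {1..n} ?s i) (right_smaller k {1..n} ?s i) =
      weight a b c (left_smaller k {1..n} g i) (right_smaller k {1..n} g i)" by simp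
  qed
next
  fix \<sigma> :: "nat \<Rightarrow> nat" assume s: "\<sigma> \<in> {\<sigma>. \<sigma> permutes {1..n}}"
  then have s': "\<sigma> permutes {1..n}" by simp
  show "(\<lambda>i. if i \<in> {1..n} then if i \<in> {1..n} then \<sigma> i else 0 else i) = \<sigma>"
    using permutes_not_in[OF s'] by auto
  have "bij_betw (\<lambda>i. if i \<in> {1..n} then \<sigma> i else 0) {1..n} {1..n}"
    using permutes_imp_bij[OF s'] by (rule bij_betw_cong[THEN iffD1, rotated]) auto
  then show "(\<lambda>i. if i \<in> {1..n} then \<sigma> i else 0) \<in> arrangements {1..n}"
    by (auto simp: arrangements_def)
qed

lemma des_A_eq_card_right_smaller:
  "des_A n k \<sigma> = card {i \<in> {1..n}. right_smaller k {1..n} \<sigma> i}"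
  unfolding des_A_def right_smaller_def by (rule arg_cong[where f = card]) auto

text \<open>Each of the \<open>n - k\<close> pairs \<open>i\<close>, \<open>i + k\<close> is a
  descent, counted at \<open>i\<close>, or an ascent, counted at \<open>i + k\<close>.\<close>

lemma card_left_smaller:
  assumes "\<sigma> permutes {1..n}" "k > 0"
  shows "card {i \<in> {1..n}. left_smaller k {1..n} \<sigma> i} + des_A n k \<sigma> = n - k"
proof -
  have ne: "\<sigma> i \<noteq> \<sigma> (i + k)" for i
    using inj_eq[OF permutes_inj[OF assms(1)], of i "i + k"] assms(2) by simp
  have "{i \<in> {1..n}. left_smaller k {1..n} \<sigma> i} = (\<lambda>i. i + k) ` {i \<in> {1..n - k}. \<sigma> i < \<sigma> (i + k)}"
    (is "?L = ?R")
  proof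
    show "?L \<subseteq> ?R"
    proof
      fix i assume "i \<in> ?L"
      then obtain j where "j \<in> {1..n}" "i = j + k" "\<sigma> j < \<sigma> i" "i \<le> n"
        by (auto simp: left_smaller_def)
      then show "i \<in> ?R" by (intro image_eqI[of _ _ j]) auto
    qed
    show "?R \<subseteq> ?L" by (auto simp: left_smaller_def)
  qed
  then have "card {i \<in> {1..n}. left_smaller k {1..n} \<sigma> i} = card {i \<in> {1..n - k}. \<sigma> i < \<sigma> (i + k)}"
    by (simp add: card_image)
  moreover have "card {i \<in> {1..n - k}. \<sigma> i < \<sigma> (i + k)} + des_A n k \<sigma> =
      card ({i \<in> {1..n - k}. \<sigma> i < \<sigma> (i + k)} \<union> {i \<in> {1..n - k}. \<sigma> i > \<sigma> (i + k)})"
    unfolding des_A_def by (rule card_Un_disjoint[symmetric]) auto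
  moreover have "{i \<in> {1..n - k}. \<sigma> i < \<sigma> (i + k)} \<union> {i \<in> {1..n - k}. \<sigma> i > \<sigma> (i + k)} = {1..n - k}"
    using ne[unfolded nat_neq_iff] by blast
  ultimately show ?thesis by simp
qed

text \<open>The padding makes a missing neighbour larger on both sides. By injectivity there are no
  ties, so a double descent is exactly a position with \<open>right_smaller\<close> and without
  \<open>left_smaller\<close>.\<close>

lemma ddes_A_eq_0_iff:
  assumes "\<sigma> permutes {1..n}" "k > 0"
  shows "ddes_A n k \<sigma> = 0 \<longleftrightarrow>
    (\<forall>i\<in>{1..n}. right_smaller k {1..n} \<sigma> i \<longrightarrow> left_smaller k {1..n} \<sigma> i)"
proof -
  have ne: "\<sigma> (i - k) \<noteq> \<sigma> i" if "k < i" for i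
    using inj_eq[OF permutes_inj[OF assms(1)], of "i - k" i] assms(2) that by simp
  let ?Q = "\<lambda>i::int. padded n \<sigma> (i - int k) > padded n \<sigma> i \<and> padded n \<sigma> i > padded n \<sigma> (i + int k)"
  have l: "padded n \<sigma> (int i - int k) > padded n \<sigma> (int i) \<longleftrightarrow> \<not> left_smaller k {1..n} \<sigma> i"
    if "i \<in> {1..n}" for i
  proof (cases "k < i")
    case True
    then have "nat (int i - int k) = i - k" by simp
    moreover have "left_smaller k {1..n} \<sigma> i \<longleftrightarrow> \<sigma> (i - k) < \<sigma> i"
      using True that by (auto simp: left_smaller_def intro!: bexI[of _ "i - k"])
    ultimately show ?thesis using True that ne[OF True] by (auto simp: padded_def)
  next
    case False
    then show ?thesis using that by (auto simp: padded_def left_smaller_def)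
  qed
  have r: "padded n \<sigma> (int i) > padded n \<sigma> (int i + int k) \<longleftrightarrow> right_smaller k {1..n} \<sigma> i"
    if "i \<in> {1..n}" for i
    using that by (auto simp: padded_def right_smaller_def nat_add_distrib)
  have "ddes_A n k \<sigma> = 0 \<longleftrightarrow> {i \<in> {1..int n}. ?Q i} = {}"
    unfolding ddes_A_def by (rule card_0_eq) (rule finite_subset[of _ "{1..int n}"], auto)
  also have "\<dots> \<longleftrightarrow> (\<forall>i\<in>int ` {1..n}. \<not> ?Q i)"
    by (auto simp: image_int_atLeastAtMost)
  also have "\<dots> \<longleftrightarrow> (\<forall>i\<in>{1..n}. right_smaller k {1..n} \<sigma> i \<longrightarrow> left_smaller k {1..n} \<sigma> i)"
    using l r by auto
  finally show ?thesis .
qed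

text \<open>With these weights only the right flag matters: a factor \<open>x\<close> for every
  descent.\<close>

lemma prod_weight_des:
  "(\<Prod>i\<in>{1..n}. weight x 1 x (left_smaller k {1..n} \<sigma> i) (right_smaller k {1..n} \<sigma> i)) =
   x ^ des_A n k \<sigma>"
proof -
  have "weight x 1 x l r = (if r then x else 1)" for l r
    by (cases l; cases r) auto
  then show ?thesis
    by (simp add: des_A_eq_card_right_smaller prod.inter_filter[symmetric])
qed

text \<open>A double descent contributes the factor 0. Without one, every descent position is a peak
  and gives \<open>x\<close>, while \<open>y\<close> comes from the double ascents: the
  \<open>n - k - des\<close> positions with a smaller left neighbour, minus the \<open>des\<close>
  peaks.\<close>

lemma prod_weight_ddes_free:
  assumes "\<sigma> permutes {1..n}" "k > 0"
  shows "(\<Prod>i\<in>{1..n}. weight 0 y x (left_smaller k {1..n} \<sigma> i) (right_smaller k {1..n} \<sigma> i)) =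
    (if ddes_A n k \<sigma> = 0 then x ^ des_A n k \<sigma> * y ^ (n - k - 2 * des_A n k \<sigma>) else 0)"
proof (cases "ddes_A n k \<sigma> = 0")
  case True
  define l where "l = left_smaller k {1..n} \<sigma>"
  define r where "r = right_smaller k {1..n} \<sigma>"
  have rl: "l i" if "i \<in> {1..n}" "r i" for i
    using True that ddes_A_eq_0_iff[OF assms] by (auto simp: l_def r_def)
  have des: "card {i \<in> {1..n}. r i} = des_A n k \<sigma>"
    by (simp add: des_A_eq_card_right_smaller r_def)
  have "card {i \<in> {1..n}. l i \<and> \<not> r i} + card {i \<in> {1..n}. r i} =
      card ({i \<in> {1..n}. l i \<and> \<not> r i} \<union> {i \<in> {1..n}. r i})"
    by (rule card_Un_disjoint[symmetric]) auto
  also have "{i \<in> {1..n}. l i \<and> \<not> r i} \<union> {i \<in> {1..n}. r i} = {i \<in> {1..n}. l i}"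
    using rl by auto
  finally have da: "card {i \<in> {1..n}. l i \<and> \<not> r i} = n - k - 2 * des_A n k \<sigma>"
    using card_left_smaller[OF assms] des by (simp add: l_def)
  have "(\<Prod>i\<in>{1..n}. weight 0 y x (l i) (r i)) =
      (\<Prod>i\<in>{1..n}. (if r i then x else 1) * (if l i \<and> \<not> r i then y else 1))"
  proof (rule prod.cong[OF refl])
    fix i assume "i \<in> {1..n}"
    then show "weight 0 y x (l i) (r i) = (if r i then x else 1) * (if l i \<and> \<not> r i then y else 1)"
      using rl[of i] by (cases "l i"; cases "r i") auto
  qed
  also have "\<dots> = x ^ card {i \<in> {1..n}. r i} * y ^ card {i \<in> {1..n}. l i \<and> \<not> r i}"
    by (simp add: prod.distrib prod.inter_filter[symmetric])
  finally show ?thesis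
    unfolding da des using True by (simp add: l_def r_def)
next
  case False
  then obtain i where i: "i \<in> {1..n}" "right_smaller k {1..n} \<sigma> i" "\<not> left_smaller k {1..n} \<sigma> i"
    unfolding ddes_A_eq_0_iff[OF assms] by blast
  then have "weight 0 y x (left_smaller k {1..n} \<sigma> i) (right_smaller k {1..n} \<sigma> i) = 0"
    by simp
  then have "(\<Prod>i\<in>{1..n}. weight 0 y x (left_smaller k {1..n} \<sigma> i) (right_smaller k {1..n} \<sigma> i)) = 0"
    using i(1) by (intro prod_zero) auto
  then show ?thesis using False by simp
qed

text \<open>All descent positions have a smaller left neighbour, so \<open>des\<close> is at most
  \<open>n - k - des\<close>. This bounds the range of \<open>p\<close> in the final sum.\<close>

lemma des_A_le_of_ddes_free:
  assumes "\<sigma> permutes {1..n}" "k > 0" "ddes_A n k \<sigma> = 0"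
  shows "des_A n k \<sigma> \<le> (n - k) div 2"
proof -
  have "des_A n k \<sigma> \<le> card {i \<in> {1..n}. left_smaller k {1..n} \<sigma> i}"
    unfolding des_A_eq_card_right_smaller
    using assms ddes_A_eq_0_iff[OF assms(1,2)] by (intro card_mono) auto
  then show ?thesis using card_left_smaller[OF assms(1,2)] by simp
qed

theorem theorem13:
  fixes n k :: nat
  assumes "n \<ge> 1" and "1 \<le> k" and "k \<le> n - 1"
  shows "WA n k = (\<Sum>p = 0..(n - k) div 2.
           of_nat (gamma_A n k p) * X ^ p * (1 + X) ^ (n - k - 2 * p))"
proof -
  have k: "k > 0" using assms by simp
  let ?f = "\<lambda>p. X ^ p * (1 + X) ^ (n - k - 2 * p)"
  let ?S = "{\<sigma>. \<sigma> permutes {1..n} \<and> ddes_A n k \<sigma> = 0}"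
  have fin: "finite {\<sigma>. \<sigma> permutes {1..n}}" by (rule finite_permutations) simp
  have "WA n k = weighted_sum X 1 X k {1..n}"
    unfolding WA_def weighted_sum_permutations prod_weight_des ..
  \<comment> \<open>Both pairs of weights for double descents and double ascents add up to
    \<open>1 + X\<close>.\<close>
  also have "\<dots> = weighted_sum 0 (1 + X) X k {1..n}"
    using k by (intro weighted_sum_cong_add) auto
  also have "\<dots> = (\<Sum>\<sigma> | \<sigma> permutes {1..n}. if ddes_A n k \<sigma> = 0 then ?f (des_A n k \<sigma>) else 0)"
    unfolding weighted_sum_permutations
    by (rule sum.cong[OF refl], rule prod_weight_ddes_free[OF _ k]) simp
  also have "\<dots> = (\<Sum>\<sigma>\<in>?S. ?f (des_A n k \<sigma>))"
    using sum.inter_filter[OF fin, of "\<lambda>\<sigma>. ?f (des_A n k \<sigma>)" "\<lambda>\<sigma>. ddes_A n k \<sigma> = 0"] by simp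
  \<comment> \<open>Group by the number of descents; the bound on it ensures that no permutation is
    lost.\<close>
  also have "\<dots> = (\<Sum>p = 0..(n - k) div 2. \<Sum>\<sigma> | \<sigma> \<in> ?S \<and> des_A n k \<sigma> = p. ?f (des_A n k \<sigma>))"
    using fin des_A_le_of_ddes_free[OF _ k]
    by (intro sum.group[symmetric]) (auto intro: finite_subset)
  also have "\<dots> = (\<Sum>p = 0..(n - k) div 2. of_nat (gamma_A n k p) * X ^ p * (1 + X) ^ (n - k - 2 * p))"
  proof (rule sum.cong[OF refl])
    fix p
    have "{\<sigma> \<in> ?S. des_A n k \<sigma> = p} = Gamma_A n k p" by (auto simp: Gamma_A_def)
    moreover have "(\<Sum>\<sigma> | \<sigma> \<in> ?S \<and> des_A n k \<sigma> = p. ?f (des_A n k \<sigma>)) =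
        (\<Sum>\<sigma> | \<sigma> \<in> ?S \<and> des_A n k \<sigma> = p. ?f p)"
      by (rule sum.cong) auto
    ultimately show "(\<Sum>\<sigma> | \<sigma> \<in> ?S \<and> des_A n k \<sigma> = p. ?f (des_A n k \<sigma>)) =
        of_nat (gamma_A n k p) * X ^ p * (1 + X) ^ (n - k - 2 * p)"
      by (simp only: sum_constant gamma_A_def mult.assoc)
  qed
  finally show ?thesis .
qed

end
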